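(* Let $M\ge1$ be an integer, $N=2M+1$, let $\rho>0$ be a constant (the boundary is the circle of radius $\rho$), and let $R_0>0$. Let $S\in\mathbb R^{N\times(2M+1)}$ and $S_{R_0}\in\mathbb R^{(2M+1)\times(2M+1)}$ be the matrices defined in the context. Then $$\det(S_{R_0})=\left(\frac{R_0}\rho\right)^{M(M+1)},\qquad \det(S)=\frac{N^{M+1/2}}{2^M}\left(\frac{R_0}\rho\right)^{M(M+1)}.$$ Hence $S$ is not singular; namely, the approximate solution by the modified Trefftz method is uniquely determined, i.e. for every $\boldsymbol g\in\mathbb R^N$ the linear system $S\boldsymbol y=\boldsymbol g$ has exactly one solution $\boldsymbol y\in\mathbb R^{2M+1}$.
   Context: Put $\theta_j=2\pi(j-1)/N$ for $j=1,\dots,N$. The matrix $S$ has entries $$S_{j,1}=1,\quad S_{j,2k}=\left(\frac{R_0}{\rho}\right)^k\cos k\theta_j,\quad S_{j,2k+1}=\left(\frac{R_0}{\rho}\right)^k\sin k\theta_j\qquad(j=1,\dots,N;\ k=1,\dots,M).$$ The matrix $S_{R_0}$ is diagonal with $(S_{R_0})_{1,1}=1$ and $(S_{R_0})_{2k,2k}=(S_{R_0})_{2k+1,2k+1}=(R_0/\rho)^k$ for $k=1,\dots,M$. The modified Trefftz method (MTM) with characteristic length $R_0$ seeks an approximate solution $a_0+\sum_{k=1}^M(a_k\cos k\theta+b_k\sin k\theta)(R_0/r)^k$ for $r\ge\rho$, whose coefficient vector $\boldsymbol y=(a_0,a_1,b_1,\dots,a_M,b_M)^T$ is determined by collocation at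 the points $(r,\theta)=(\rho,\theta_j)$ with data $g_j$, i.e. by $S\boldsymbol y=\boldsymbol g$ with $\boldsymbol g=(g_1,\dots,g_N)^T$. *)

theory Defs
  imports Complex_Main "Jordan_Normal_Form.Determinant"
begin

definition colloc_angle :: "nat \<Rightarrow> nat \<Rightarrow> real" where
  "colloc_angle N j = 2 * pi * (real j - 1) / real N"

text \<open>Matrices and vectors are indexed from 0, whereas the collocation points are numbered
  from 1: row \<open>i\<close> belongs to the point number \<open>i + 1\<close>.  Column \<open>0\<close> is
  the constant mode, and columns \<open>2 * k - 1\<close> and \<open>2 * k\<close> are the cosine and
  the sine modes of order \<open>k\<close> for \<open>k = 1, \<dots>, M\<close>; hence the order of the mode
  in column \<open>c\<close> is \<open>(c + 1) div 2\<close>.\<close>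

definition mtm_mat :: "nat \<Rightarrow> nat \<Rightarrow> real \<Rightarrow> real \<Rightarrow> real mat" where
  "mtm_mat N M \<rho> R0 = mat N (2 * M + 1) (\<lambda>(i, c).
     let k = (c + 1) div 2; \<theta> = colloc_angle N (i + 1) in
     if c = 0 then 1
     else if odd c then (R0 / \<rho>) ^ k * cos (real k * \<theta>)
     else (R0 / \<rho>) ^ k * sin (real k * \<theta>))"

definition scaling_mat :: "nat \<Rightarrow> real \<Rightarrow> real \<Rightarrow> real mat" where
  "scaling_mat M \<rho> R0 = mat (2 * M + 1) (2 * M + 1) (\<lambda>(r, c).
     if r \<noteq> c then 0 else if c = 0 then 1 else (R0 / \<rho>) ^ ((c + 1) div 2))"

text \<open>The entries in 1-based numbering.\<close>

lemma mtm_mat_entries: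
  assumes "j \<in> {1..N}" and "k \<in> {1..M}"
  shows "mtm_mat N M \<rho> R0 $$ (j - 1, 1 - 1) = 1"
    and "mtm_mat N M \<rho> R0 $$ (j - 1, 2 * k - 1)
           = (R0 / \<rho>) ^ k * cos (real k * colloc_angle N j)"
    and "mtm_mat N M \<rho> R0 $$ (j - 1, (2 * k + 1) - 1)
           = (R0 / \<rho>) ^ k * sin (real k * colloc_angle N j)"
  using assms by (auto simp: mtm_mat_def Let_def)

lemma scaling_mat_entries:
  assumes "k \<in> {1..M}"
  shows "scaling_mat M \<rho> R0 $$ (1 - 1, 1 - 1) = 1"
    and "scaling_mat M \<rho> R0 $$ (2 * k - 1, 2 * k - 1) = (R0 / \<rho>) ^ k"
    and "scaling_mat M \<rho> R0 $$ ((2 * k + 1) - 1, (2 * k + 1) - 1) = (R0 / \<rho>) ^ k"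
  using assms by (auto simp: scaling_mat_def)

text \<open>The approximate solution with coefficients \<open>y = (a\<^sub>0, a\<^sub>1, b\<^sub>1, \<dots>, a\<^sub>M, b\<^sub>M)\<close>;
  its collocation equations are the linear system with matrix \<^const>\<open>mtm_mat\<close>.\<close>

definition mtm_approx :: "nat \<Rightarrow> real \<Rightarrow> real vec \<Rightarrow> real \<Rightarrow> real \<Rightarrow> real" where
  "mtm_approx M R0 y r \<theta> = y $ 0 +
     (\<Sum>k=1..M. (y $ (2 * k - 1) * cos (real k * \<theta>) + y $ (2 * k) * sin (real k * \<theta>))
                 * (R0 / r) ^ k)"

lemma sum_modes:
  fixes f :: "nat \<Rightarrow> real"
  shows "sum f {0..<2 * M + 1} = f 0 + (\<Sum>k=1..M. f (2 * k - 1) + f (2 * k))"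
  by (induction M) (auto simp: algebra_simps)

lemma mtm_mat_collocation:
  assumes y: "y \<in> carrier_vec (2 * M + 1)" and g: "g \<in> carrier_vec N"
  shows "mtm_mat N M \<rho> R0 *\<^sub>v y = g \<longleftrightarrow>
         (\<forall>j\<in>{1..N}. mtm_approx M R0 y \<rho> (colloc_angle N j) = g $ (j - 1))"
proof -
  have dims: "dim_row (mtm_mat N M \<rho> R0) = N" "dim_col (mtm_mat N M \<rho> R0) = 2 * M + 1"
    by (simp_all add: mtm_mat_def)
  have *: "(mtm_mat N M \<rho> R0 *\<^sub>v y) $ (j - 1) = mtm_approx M R0 y \<rho> (colloc_angle N j)"
    if j: "j \<in> {1..N}" for j
  proof -
    have "(mtm_mat N M \<rho> R0 *\<^sub>v y) $ (j - 1)
        = (\<Sum>c\<in>{0..<2 * M + 1}. mtm_mat N M \<rho> R0 $$ (j - 1, c) * y $ c)"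
      using j y dims by (auto simp: scalar_prod_def intro!: sum.cong)
    also have "\<dots> = mtm_approx M R0 y \<rho> (colloc_angle N j)"
      unfolding sum_modes mtm_approx_def
      using j by (auto simp: mtm_mat_def Let_def algebra_simps intro!: sum.cong)
    finally show ?thesis .
  qed
  have "mtm_mat N M \<rho> R0 *\<^sub>v y = g \<longleftrightarrow> (\<forall>i<N. (mtm_mat N M \<rho> R0 *\<^sub>v y) $ i = g $ i)"
    using g dims by (auto intro!: eq_vecI)
  also have "\<dots> \<longleftrightarrow> (\<forall>j\<in>{1..N}. (mtm_mat N M \<rho> R0 *\<^sub>v y) $ (j - 1) = g $ (j - 1))"
  proof (intro iffI ballI allI impI)
    fix i assume a: "\<forall>j\<in>{1..N}. (mtm_mat N M \<rho> R0 *\<^sub>v y) $ (j - 1) = g $ (j - 1)" and "i < N"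
    then show "(mtm_mat N M \<rho> R0 *\<^sub>v y) $ i = g $ i"
      using bspec[OF a, of "Suc i"] by simp
  qed auto
  finally show ?thesis using * by auto
qed

end

theory Submission
  imports Defs
begin

text \<open>Factoring out the scaling matrix leaves the matrix \<open>T\<close> of the trigonometric modes at the
  \<open>N\<close> equispaced nodes. Discrete orthogonality makes \<open>T\<^sup>T T\<close> diagonal with entries
  \<open>N, N/2, \<dots>, N/2\<close>, which gives \<open>(det T)\<^sup>2\<close>. The sign comes from a Vandermonde-type
  argument for arbitrary nodes \<open>x\<^sub>0 < \<dots> < x\<^sub>2\<^sub>n < x\<^sub>0 + 2 \<pi>\<close>: a product of \<open>2 k\<close> factors
  \<open>2 sin ((t - y\<^sub>i) / 2)\<close> is a trigonometric polynomial of degree \<open>k\<close> with explicit leading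
  term, so column operations replace the two modes of top order by such products vanishing at
  the earlier nodes, and the determinant becomes a product of positive sines.\<close>

section \<open>Trigonometric modes and trigonometric polynomials\<close>

text \<open>A sine is a cosine delayed by \<open>pi / 2\<close>, so every mode becomes one shifted
  cosine and a single product-to-sum formula serves all pairs of modes. Column 0 is even but must
  give \<open>cos 0\<close>, hence the exception.\<close>

definition mode_phase :: "nat \<Rightarrow> real" where
  "mode_phase c = (if odd c \<or> c = 0 then 0 else pi / 2)"

definition trig_mode :: "nat \<Rightarrow> real \<Rightarrow> real" where
  "trig_mode c t = cos (real ((c + 1) div 2) * t - mode_phase c)"

lemma trig_mode_simps:
  "trig_mode 0 t = 1"
  "k \<ge> 1 \<Longrightarrow> trig_mode (2 * k - 1) t = cos (real k * t)"
  "k \<ge> 1 \<Longrightarrow> trig_mode (2 * k) t = sin (real k * t)"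
  "trig_mode (Suc (2 * k)) t = cos (real (Suc k) * t)"
  "trig_mode (Suc (Suc (2 * k))) t = sin (real (Suc k) * t)"
  by (auto simp: trig_mode_def mode_phase_def cos_diff)

text \<open>Generating by cosines of arbitrary phase, rather than by the modes, makes closure under
  multiplication by a shifted cosine a direct induction.\<close>

inductive_set trig_poly :: "nat \<Rightarrow> (real \<Rightarrow> real) set" for n where
  mono: "m \<le> n \<Longrightarrow> (\<lambda>t. a * cos (real m * t - p)) \<in> trig_poly n"
| add: "f \<in> trig_poly n \<Longrightarrow> g \<in> trig_poly n \<Longrightarrow> (\<lambda>t. f t + g t) \<in> trig_poly n"

lemma trig_poly_mono:
  assumes "f \<in> trig_poly n" "n \<le> m"
  shows "f \<in> trig_poly m"
  using assms by induction (auto intro: trig_poly.intros)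

lemma trig_poly_scale:
  assumes "f \<in> trig_poly n"
  shows "(\<lambda>t. b * f t) \<in> trig_poly n"
  using assms
proof induction
  case (mono m a p)
  then show ?case using trig_poly.mono[of m n "b * a" p] by (simp add: mult.assoc)
next
  case (add f g)
  then show ?case using trig_poly.add by (simp add: distrib_left)
qed

lemma trig_poly_mult_cos:
  assumes "f \<in> trig_poly n"
  shows "(\<lambda>t. f t * cos (t - q)) \<in> trig_poly (Suc n)"
  using assms
proof induction
  case (mono m a p)
  have up: "(\<lambda>t. a / 2 * cos (real (Suc m) * t - (p + q))) \<in> trig_poly (Suc n)"
    using mono by (intro trig_poly.mono) simp
  have down: "(\<lambda>t. a / 2 * cos ((real m - 1) * t - (p - q))) \<in> trig_poly (Suc n)"
  proof (cases m)
    \<comment> \<open>The lowered frequency is -1 here; evenness of cosine turns it into frequency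
      1, which the bound \<open>Suc n\<close> allows.\<close>
    case 0
    have "cos ((real m - 1) * t - (p - q)) = cos (real (Suc 0) * t - (q - p))" for t
      using cos_minus[of "t - (q - p)"] 0 by (simp add: algebra_simps)
    then show ?thesis using trig_poly.mono[of "Suc 0" "Suc n" "a / 2" "q - p"] by simp
  next
    case (Suc l)
    then show ?thesis using trig_poly.mono[of l "Suc n" "a / 2" "p - q"] mono by simp
  qed
  have "a * cos (real m * t - p) * cos (t - q)
      = a / 2 * cos (real (Suc m) * t - (p + q)) + a / 2 * cos ((real m - 1) * t - (p - q))" for t
    using cos_times_cos[of "real m * t - p" "t - q"] by (simp add: algebra_simps add_divide_distrib)
  then show ?case using trig_poly.add[OF up down] by simp
next
  case (add f g)
  then show ?case using trig_poly.add by (simp add: distrib_right)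
qed

text \<open>The addition formula splits each shifted cosine into modes. The sum is written as a row
  of \<open>trig_mat\<close> times a coefficient column, ready for block multiplication.\<close>

lemma trig_poly_coeffs:
  assumes "f \<in> trig_poly n"
  obtains a where "\<And>t. f t = (\<Sum>c\<in>{0..<2 * n + 1}. trig_mode c t * a c)"
proof -
  have "\<exists>a. \<forall>t. f t = (\<Sum>c\<in>{0..<2 * n + 1}. trig_mode c t * a c)"
    using assms
  proof induction
    case (mono m b p)
    define a where "a c = (if (c + 1) div 2 = m then
        b * (if odd c \<or> c = 0 then cos p else sin p) else 0)" for c
    have "(\<Sum>c\<in>{0..<2 * n + 1}. trig_mode c t * a c) = b * cos (real m * t - p)" for t
    proof -
      have "(\<Sum>c\<in>{0..<2 * n + 1}. trig_mode c t * a c)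
          = a 0 + (\<Sum>k=1..n. if k = m then b * cos (real k * t - p) else 0)"
        unfolding sum_modes
      proof (intro arg_cong2[where f = "(+)"] sum.cong)
        fix k assume k: "k \<in> {1..n}"
        then have "a (2 * k - 1) = (if k = m then b * cos p else 0)"
          "a (2 * k) = (if k = m then b * sin p else 0)"
          by (auto simp: a_def)
        then show "trig_mode (2 * k - 1) t * a (2 * k - 1) + trig_mode (2 * k) t * a (2 * k)
            = (if k = m then b * cos (real k * t - p) else 0)"
          using k by (simp only: trig_mode_simps(2,3) atLeastAtMost_iff)
            (simp add: cos_diff algebra_simps)
      qed (simp_all add: trig_mode_simps)
      also have "\<dots> = b * cos (real m * t - p)"
        using mono by (cases "m = 0") (auto simp: a_def)
      finally show ?thesis .
    qed
    then show ?case by metis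
  next
    case (add f g)
    then obtain a b where "\<forall>t. f t = (\<Sum>c\<in>{0..<2 * n + 1}. trig_mode c t * a c)"
      "\<forall>t. g t = (\<Sum>c\<in>{0..<2 * n + 1}. trig_mode c t * b c)" by auto
    then have "\<forall>t. f t + g t = (\<Sum>c\<in>{0..<2 * n + 1}. trig_mode c t * (a c + b c))"
      by (simp add: distrib_left sum.distrib)
    then show ?case by (intro exI[of _ "\<lambda>c. a c + b c"])
  qed
  then show ?thesis using that by blast
qed

section \<open>Products of half-angle sines\<close>

lemma sin_half_times_sin_half:
  fixes t u v :: real
  shows "2 * sin ((t - u) / 2) * (2 * sin ((t - v) / 2))
    = 2 * cos ((u - v) / 2) - 2 * cos (t - (u + v) / 2)"
proof -
  have "(t - v) / 2 - (t - u) / 2 = (u - v) / 2" "(t - v) / 2 + (t - u) / 2 = t - (u + v) / 2"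
    by (simp_all add: field_simps)
  then show ?thesis
    using sin_times_sin[of "(t - v) / 2" "(t - u) / 2"] by (simp only:) (simp add: mult_ac)
qed

text \<open>Zeros are added in pairs, since two half-angle factors together form a trigonometric
  polynomial of degree 1. Multiplying the old leading term by \<open>cos (t - q)\<close> yields the
  new one plus a term two degrees lower.\<close>

lemma sin_prod_minus_leading_term:
  "(\<lambda>t. (\<Prod>i<2 * Suc n. 2 * sin ((t - y i) / 2))
      - 2 * (-1) ^ Suc n * cos (real (Suc n) * t - (\<Sum>i<2 * Suc n. y i) / 2)) \<in> trig_poly n"
proof (induction n)
  case 0
  have "(\<Prod>i<2 * Suc 0. 2 * sin ((t - y i) / 2))
      - 2 * (-1) ^ Suc 0 * cos (real (Suc 0) * t - (\<Sum>i<2 * Suc 0. y i) / 2)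
      = 2 * cos ((y 0 - y 1) / 2) * cos (real 0 * t - 0)" for t
    using sin_half_times_sin_half[of t "y 0" "y 1"] by (simp add: numeral_2_eq_2)
  then show ?case by (simp only:) (rule trig_poly.mono, simp)
next
  case (Suc n)
  let ?k = "Suc n"
  define A where "A = (\<Sum>i<2 * ?k. y i) / 2"
  define P where "P t = (\<Prod>i<2 * ?k. 2 * sin ((t - y i) / 2))" for t
  define f where "f t = P t - 2 * (-1) ^ ?k * cos (real ?k * t - A)" for t
  define u v where "u = y (2 * ?k)" and "v = y (Suc (2 * ?k))"
  define d q where "d = (u - v) / 2" and "q = (u + v) / 2"
  have f: "f \<in> trig_poly n" using Suc unfolding f_def P_def A_def .
  have fac: "2 * sin ((t - u) / 2) * (2 * sin ((t - v) / 2)) = 2 * cos d - 2 * cos (t - q)" for t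
    unfolding d_def q_def by (rule sin_half_times_sin_half)
  have prod: "(\<Prod>i<2 * Suc ?k. 2 * sin ((t - y i) / 2)) = P t * (2 * cos d - 2 * cos (t - q))" for t
    unfolding fac[symmetric] by (simp add: P_def u_def v_def mult.assoc del: mult_cancel_left)
  have sum: "(\<Sum>i<2 * Suc ?k. y i) / 2 = A + q"
    by (simp add: A_def q_def u_def v_def field_simps)
  have cc: "2 * (cos (real ?k * t - A) * cos (t - q))
      = cos (real (Suc ?k) * t - (A + q)) + cos (real n * t - (A - q))" for t
    using cos_times_cos[of "real ?k * t - A" "t - q"] by (simp add: algebra_simps)
  \<comment> \<open>\<open>P t\<close> is replaced by \<open>f t\<close> plus its leading term.
    After cancellation of the new leading term the four summands have degrees at most
    \<open>n\<close>, \<open>n + 1\<close>, \<open>n + 1\<close> and \<open>n\<close>.\<close>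
  have eq: "P t * (2 * cos d - 2 * cos (t - q))
        - 2 * (-1) ^ Suc ?k * cos (real (Suc ?k) * t - (A + q))
      = 2 * cos d * f t + (- 2) * (f t * cos (t - q))
        + ((4 * (-1) ^ ?k * cos d) * cos (real ?k * t - A)
        + (2 * (-1) ^ Suc ?k) * cos (real n * t - (A - q)))" for t
    using arg_cong[OF cc[of t], of "\<lambda>x. 2 * (-1) ^ Suc ?k * x"]
    unfolding f_def by (simp add: algebra_simps)
  show ?case
    unfolding prod sum eq
    by (intro trig_poly.add trig_poly_scale trig_poly_mult_cos trig_poly.mono f
        trig_poly_mono[OF f]) simp_all
qed

section \<open>The determinant at arbitrary nodes\<close>

definition trig_mat :: "nat \<Rightarrow> (nat \<Rightarrow> real) \<Rightarrow> real mat" where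
  "trig_mat n x = mat n n (\<lambda>(i, c). trig_mode c (x i))"

lemma trig_mat_carrier [simp]: "trig_mat n x \<in> carrier_mat n n"
  by (simp add: trig_mat_def)

lemma sum_atLeast0_2: "(\<Sum>c\<in>{0..<2}. f c) = f 0 + f (1::nat)"
  by (simp add: numeral_2_eq_2)

lemma det_mat_2:
  fixes A :: "'a :: comm_ring_1 mat"
  assumes "A \<in> carrier_mat 2 2"
  shows "det A = A $$ (0, 0) * A $$ (1, 1) - A $$ (0, 1) * A $$ (1, 0)"
proof -
  have "det A = (\<Sum>i<2. A $$ (i, 0) * cofactor A i 0)"
    using assms by (rule laplace_expansion_column) simp
  then show ?thesis
    using assms by (simp add: numeral_2_eq_2 cofactor_def det_single mat_delete_def mult.commute)
qed

text \<open>Right multiplication by a block upper triangular matrix of determinant 4 turns the last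
  two columns into values of \<open>G 0\<close> and \<open>G 1\<close>, which vanish at the first
  \<open>K\<close> nodes. The auxiliary zero of \<open>G 0\<close> contributes 2 on the other side,
  leaving the factor 2.\<close>

lemma det_trig_mat_step:
  "2 * det (trig_mat (2 * Suc n + 1) x) = det (trig_mat (2 * n + 1) x)
    * (\<Prod>i<2 * n + 1. 2 * sin ((x (2 * n + 1) - x i) / 2))
    * (\<Prod>i<2 * n + 2. 2 * sin ((x (2 * n + 2) - x i) / 2))"
proof -
  define K where "K = 2 * n + 1"
  text \<open>The product \<open>G 0\<close> has one zero more than needed. It is placed at distance \<open>\<pi>\<close> from
    \<open>x K\<close>, where its factor contributes \<open>2 sin (\<pi> / 2)\<close> and the leading terms of \<open>G 0\<close> and
    \<open>G 1\<close> differ in phase by \<open>\<pi> / 2\<close>.\<close>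
  define y where "y b = (if b = 0 then x(K := x K - pi) else x)" for b :: nat
  define G where "G b t = (\<Prod>i<2 * Suc n. 2 * sin ((t - y b i) / 2))" for b t
  define B where "B b = (\<Sum>i<2 * Suc n. y b i) / 2" for b
  define s :: real where "s = 2 * (-1) ^ Suc n"
  have SK: "2 * Suc n = Suc K" by (simp add: K_def)
  have "\<exists>a. \<forall>t. G b t - s * cos (real (Suc n) * t - B b) = (\<Sum>c\<in>{0..<K}. trig_mode c t * a c)" for b
    by (rule trig_poly_coeffs[OF sin_prod_minus_leading_term[where n = n and y = "y b"]])
      (auto simp only: G_def s_def B_def K_def)
  then have "\<exists>a. \<forall>b t. G b t - s * cos (real (Suc n) * t - B b)
      = (\<Sum>c\<in>{0..<K}. trig_mode c t * a b c)"
    by (intro choice allI)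
  then obtain a where a:
    "G b t - s * cos (real (Suc n) * t - B b) = (\<Sum>c\<in>{0..<K}. trig_mode c t * a b c)" for b t
    by blast
  \<comment> \<open>Column \<open>b\<close> holds the coordinates of the leading term of
    \<open>G b\<close> in the two top modes, so \<open>det W\<close> is
    \<open>s\<^sup>2 * sin (B 1 - B 0)\<close>.\<close>
  define W where "W = mat 2 2 (\<lambda>(c, b). s * (if c = 0 then cos (B b) else sin (B b)))"
  define U where "U = mat K 2 (\<lambda>(c, b). a b c)"
  define P where "P = mat K 2 (\<lambda>(i, c). trig_mode (K + c) (x i))"
  define Q where "Q = mat 2 K (\<lambda>(i, c). trig_mode c (x (K + i)))"
  define R where "R = mat 2 2 (\<lambda>(i, c). trig_mode (K + c) (x (K + i)))"
  define R' where "R' = mat 2 2 (\<lambda>(i, b). G b (x (K + i)))"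
  have carr: "W \<in> carrier_mat 2 2" "U \<in> carrier_mat K 2" "P \<in> carrier_mat K 2"
    "Q \<in> carrier_mat 2 K" "R \<in> carrier_mat 2 2" "R' \<in> carrier_mat 2 2"
    by (simp_all add: W_def U_def P_def Q_def R_def R'_def)
  have G: "(\<Sum>c\<in>{0..<K}. trig_mode c t * a b c)
      + (trig_mode K t * (s * cos (B b)) + trig_mode (Suc K) t * (s * sin (B b))) = G b t" for b t
  proof -
    have "trig_mode K t = cos (real (Suc n) * t)" "trig_mode (Suc K) t = sin (real (Suc n) * t)"
      using trig_mode_simps(4,5)[of n t] by (simp_all add: K_def)
    then show ?thesis
      unfolding a[symmetric] cos_diff by (simp only:) (simp add: distrib_left mult_ac)
  qed
  have G_zero: "G b (x i) = 0" if "b = 1 \<or> i < K" "i < Suc K" for b i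
  proof -
    have "y b i = x i" using that by (auto simp: y_def)
    then show ?thesis unfolding G_def SK using that(2) by (intro prod_zero bexI[of _ i]) auto
  qed
  have split: "trig_mat (2 * Suc n + 1) x = four_block_mat (trig_mat K x) P Q R"
    by (rule eq_matI) (auto simp: trig_mat_def P_def Q_def R_def K_def)
  have top: "trig_mat K x * U + P * W = 0\<^sub>m K 2"
    by (rule eq_matI)
      (auto simp: trig_mat_def P_def U_def W_def scalar_prod_def sum_atLeast0_2 G G_zero)
  have bottom: "Q * U + R * W = R'"
    by (rule eq_matI)
      (auto simp: Q_def R_def R'_def U_def W_def scalar_prod_def sum_atLeast0_2 G)
  have prod: "trig_mat (2 * Suc n + 1) x * four_block_mat (1\<^sub>m K) U (0\<^sub>m 2 K) W
      = four_block_mat (trig_mat K x) (0\<^sub>m K 2) Q R'"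
    unfolding split
    by (subst mult_four_block_mat[OF trig_mat_carrier carr(3-5) one_carrier_mat carr(2)
          zero_carrier_mat carr(1)])
      (use carr in \<open>simp add: top bottom right_mult_one_mat[OF trig_mat_carrier]\<close>)
  have "B 1 - B 0 = pi / 2"
    unfolding B_def SK by (simp add: y_def field_simps)
  then have "sin (B 1 - B 0) = 1" by (simp only: sin_pi_half)
  then have "cos (B 0) * sin (B 1) - cos (B 1) * sin (B 0) = 1"
    by (simp add: sin_diff mult.commute)
  moreover have "det W = s\<^sup>2 * (cos (B 0) * sin (B 1) - cos (B 1) * sin (B 0))"
    unfolding det_mat_2[OF carr(1)] by (simp add: W_def power2_eq_square algebra_simps)
  ultimately have "det W = s\<^sup>2" by simp
  also have "s\<^sup>2 = 4" by (simp add: s_def power_mult_distrib flip: power_mult)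
  finally have detW: "det W = 4" .
  \<comment> \<open>\<open>G 1\<close> also vanishes at \<open>x K\<close>, so \<open>R'\<close> is
    lower triangular.\<close>
  have detR': "det R' = G 0 (x K) * G 1 (x (Suc K))"
    unfolding det_mat_2[OF carr(6)] by (simp add: R'_def G_zero)
  have G0: "G 0 (x K) = 2 * (\<Prod>i<K. 2 * sin ((x K - x i) / 2))"
    unfolding G_def SK by (simp add: y_def)
  have "det (trig_mat (2 * Suc n + 1) x) * det (four_block_mat (1\<^sub>m K) U (0\<^sub>m 2 K) W)
      = det (four_block_mat (trig_mat K x) (0\<^sub>m K 2) Q R')"
    unfolding prod[symmetric]
    by (rule det_mult[symmetric, where n = "K + 2"]) (use carr in \<open>auto simp: K_def\<close>)
  also have "det (four_block_mat (1\<^sub>m K) U (0\<^sub>m 2 K) W) = 4"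
    using carr detW by (subst det_four_block_mat_lower_left_zero[where n = K and m = 2]) auto
  also have "det (four_block_mat (trig_mat K x) (0\<^sub>m K 2) Q R') = det (trig_mat K x) * det R'"
    using carr by (intro det_four_block_mat_upper_right_zero[where n = K and m = 2]) auto
  finally have "2 * det (trig_mat (2 * Suc n + 1) x)
      = det (trig_mat K x) * (\<Prod>i<K. 2 * sin ((x K - x i) / 2)) * G 1 (x (Suc K))"
    unfolding detR' G0 by simp
  moreover have "G 1 (x (Suc K)) = (\<Prod>i<2 * n + 2. 2 * sin ((x (2 * n + 2) - x i) / 2))"
    by (simp add: G_def y_def K_def)
  ultimately show ?thesis by (simp add: K_def)
qed

text \<open>All nodes lie within less than one period, so each half-difference of a later and an
  earlier node is in the interval from 0 to \<open>pi\<close>, where sine is positive.\<close>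

lemma det_trig_mat_pos:
  assumes "strict_mono_on {..2 * n} x" "x (2 * n) < x 0 + 2 * pi"
  shows "det (trig_mat (2 * n + 1) x) > 0"
proof -
  have sin_pos: "2 * sin ((x j - x i) / 2) > 0" if "i < j" "j \<le> 2 * n" for i j
  proof -
    have "x i < x j" using that by (intro strict_mono_onD[OF assms(1)]) auto
    moreover have "x 0 \<le> x i" "x j \<le> x (2 * n)"
      using that by (auto intro!: monotone_onD[OF strict_mono_on_imp_mono_on[OF assms(1)]])
    ultimately show ?thesis using assms(2) by (intro mult_pos_pos sin_gt_zero) auto
  qed
  have "m \<le> n \<Longrightarrow> det (trig_mat (2 * m + 1) x) > 0" for m
  proof (induction m)
    case 0
    then show ?case by (simp add: det_single trig_mat_def trig_mode_simps)
  next
    case (Suc m)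
    have "0 < det (trig_mat (2 * m + 1) x)
        * (\<Prod>i<2 * m + 1. 2 * sin ((x (2 * m + 1) - x i) / 2))
        * (\<Prod>i<2 * m + 2. 2 * sin ((x (2 * m + 2) - x i) / 2))"
      using Suc by (intro mult_pos_pos prod_pos sin_pos) auto
    then show ?case using det_trig_mat_step[of m x] by simp
  qed
  then show ?thesis by blast
qed

section \<open>Discrete orthogonality at equispaced nodes\<close>

text \<open>This is the real part of a geometric sum over an \<open>N\<close>-th root of unity,
  rotated by the phase. The frequency is an integer because differences of mode orders may be
  negative.\<close>

lemma sum_cos_equispaced:
  fixes m :: int
  assumes "N > 0" "\<bar>m\<bar> < int N"
  shows "(\<Sum>j<N. cos (of_int m * (2 * pi * real j / real N) - p)) = (if m = 0 then real N * cos p else 0)"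
proof (cases "m = 0")
  case False
  define w where "w = cis (2 * pi * of_int m / real N)"
  have "w \<noteq> 1"
  proof
    assume "w = 1"
    then have "cos (2 * pi * of_int m / real N) = 1" by (auto simp: w_def complex_eq_iff)
    then obtain k :: int where "2 * pi * of_int m / real N = of_int k * 2 * pi"
      by (auto simp: cos_one_2pi_int)
    then have "of_int m = (of_int (k * int N) :: real)" using assms by (simp add: field_simps)
    then have "m = k * int N" by (simp only: of_int_eq_iff)
    then have "int N dvd m" by simp
    then show False using assms(2) False zdvd_not_zless[of "\<bar>m\<bar>" "int N"] by simp
  qed
  \<comment> \<open>The bound on \<open>m\<close> has excluded \<open>w = 1\<close>, so the
    geometric sum formula applies and gives 0.\<close>
  moreover have "w ^ N = 1"
    using assms(1) by (auto simp: w_def DeMoivre complex_eq_iff cos_int_2pin sin_int_2pin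
        simp flip: mult.assoc)
  ultimately have "(\<Sum>j<N. w ^ j) = 0" using geometric_sum[of w N] by simp
  then have "Re (cis (- p) * (\<Sum>j<N. w ^ j)) = 0" by simp
  also have "Re (cis (- p) * (\<Sum>j<N. w ^ j))
      = (\<Sum>j<N. cos (of_int m * (2 * pi * real j / real N) - p))"
    unfolding sum_distrib_left Re_sum
    by (intro sum.cong) (simp_all add: w_def DeMoivre cis_mult mult_ac)
  finally show ?thesis using False by simp
qed (simp add: cos_diff)

text \<open>Mode orders are at most \<open>M\<close>, so their sums and differences have absolute
  value at most \<open>2 * M < N\<close>: no aliasing occurs.\<close>

lemma trig_mode_orthogonal:
  assumes "N = 2 * M + 1" "c < N" "d < N"
  shows "(\<Sum>j<N. trig_mode c (2 * pi * real j / real N) * trig_mode d (2 * pi * real j / real N))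
    = (if c \<noteq> d then 0 else if c = 0 then real N else real N / 2)"
proof -
  define k l where "k = int ((c + 1) div 2)" and "l = int ((d + 1) div 2)"
  let ?t = "\<lambda>j. 2 * pi * real j / real N"
  have kl: "0 \<le> k" "0 \<le> l" "k \<le> int M" "l \<le> int M"
    using assms by (auto simp: k_def l_def)
  have "trig_mode c (?t j) * trig_mode d (?t j)
      = (cos (of_int (k - l) * ?t j - (mode_phase c - mode_phase d))
       + cos (of_int (k + l) * ?t j - (mode_phase c + mode_phase d))) / 2" for j
    unfolding trig_mode_def cos_times_cos by (simp add: k_def l_def algebra_simps)
  then have "(\<Sum>j<N. trig_mode c (?t j) * trig_mode d (?t j))
      = ((\<Sum>j<N. cos (of_int (k - l) * ?t j - (mode_phase c - mode_phase d)))
       + (\<Sum>j<N. cos (of_int (k + l) * ?t j - (mode_phase c + mode_phase d)))) / 2"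
    by (simp only: sum_divide_distrib[symmetric] sum.distrib)
  also have "\<dots> = ((if k - l = 0 then real N * cos (mode_phase c - mode_phase d) else 0)
       + (if k + l = 0 then real N * cos (mode_phase c + mode_phase d) else 0)) / 2"
    using kl assms(1) by (intro arg_cong2[where f = "\<lambda>a b. (a + b) / 2"] sum_cos_equispaced) auto
  also have "\<dots> = (if c \<noteq> d then 0 else if c = 0 then real N else real N / 2)"
  proof (cases "k = l")
    case True
    then have "(c + 1) div 2 = (d + 1) div 2" by (simp add: k_def l_def)
    \<comment> \<open>Distinct columns of equal order are a cosine and a sine; their phases differ
      by \<open>pi / 2\<close>, so the surviving term is 0.\<close>
    then have "c = d \<or> (odd c \<noteq> odd d \<and> c \<noteq> 0 \<and> d \<noteq> 0)" by presburger
    moreover have "k + l = 0 \<longleftrightarrow> c = 0 \<and> d = 0" by (auto simp: k_def l_def)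
    ultimately show ?thesis using True by (auto simp: mode_phase_def)
  next
    case False
    then have "c \<noteq> d" "k + l \<noteq> 0" using kl by (auto simp: k_def l_def)
    then show ?thesis using False by simp
  qed
  finally show ?thesis .
qed

section \<open>Determinants of the two factors\<close>

lemma prod_atLeast0_modes:
  fixes f :: "nat \<Rightarrow> 'a :: comm_monoid_mult"
  shows "prod f {0..<2 * M + 1} = f 0 * (\<Prod>k=1..M. f (2 * k - 1) * f (2 * k))"
  by (induction M) (auto simp: ac_simps)

lemma det_diagonal:
  fixes f :: "nat \<Rightarrow> 'a :: comm_ring_1"
  shows "det (mat n n (\<lambda>(r, c). if r \<noteq> c then 0 else f c)) = prod f {0..<n}"
proof -
  have "det (mat n n (\<lambda>(r, c). if r \<noteq> c then 0 else f c))
      = prod_list (diag_mat (mat n n (\<lambda>(r, c). if r \<noteq> c then 0 else f c)))"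
    by (rule det_upper_triangular[of _ n]) (auto intro!: upper_triangularI)
  then show ?thesis by (simp add: prod_list_diag_prod)
qed

lemma det_scaling_mat: "det (scaling_mat M \<rho> R0) = (R0 / \<rho>) ^ (M * (M + 1))"
proof -
  let ?f = "\<lambda>c. if c = 0 then 1 else (R0 / \<rho>) ^ ((c + 1) div 2)"
  have "scaling_mat M \<rho> R0 = mat (2 * M + 1) (2 * M + 1) (\<lambda>(r, c). if r \<noteq> c then 0 else ?f c)"
    unfolding scaling_mat_def by (rule cong_mat) auto
  then have "det (scaling_mat M \<rho> R0) = (\<Prod>k=1..M. ?f (2 * k - 1) * ?f (2 * k))"
    by (simp only: det_diagonal prod_atLeast0_modes) simp
  \<comment> \<open>Each order occurs twice, so the exponent is
    \<open>2 * (1 + ... + M)\<close>.\<close>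
  also have "\<dots> = (R0 / \<rho>) ^ (M * (M + 1))"
    by (induction M) (simp_all add: power_add[symmetric] algebra_simps)
  finally show ?thesis .
qed

lemma det_trig_mat_equispaced:
  assumes N: "N = 2 * M + 1"
  shows "det (trig_mat N (\<lambda>j. 2 * pi * real j / real N)) = real N powr (real M + 1 / 2) / 2 ^ M"
proof -
  let ?T = "trig_mat N (\<lambda>j. 2 * pi * real j / real N)"
  let ?r = "real N powr (real M + 1 / 2) / 2 ^ M"
  let ?f = "\<lambda>c. if c = 0 then real N else real N / 2"
  have "(det ?T)\<^sup>2 = det (?T\<^sup>T * ?T)"
    by (simp add: det_mult[where n = N] det_transpose[where n = N] power2_eq_square)
  also have "?T\<^sup>T * ?T = mat N N (\<lambda>(c, d). if c \<noteq> d then 0 else ?f d)"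
    by (rule eq_matI) (auto simp: trig_mat_def scalar_prod_def atLeast0LessThan trig_mode_orthogonal[OF N])
  also have "det \<dots> = real N * (\<Prod>k=1..M. (real N / 2)\<^sup>2)"
    unfolding det_diagonal unfolding N prod_atLeast0_modes
    by (simp add: power2_eq_square)
  also have "\<dots> = real N ^ (2 * M + 1) / 4 ^ M"
    by (simp add: power_divide flip: power_mult)
  also have "\<dots> = ?r\<^sup>2"
  proof -
    have "(real N powr (real M + 1 / 2))\<^sup>2 = real N powr real (2 * M + 1)"
      using N by (simp add: powr_power algebra_simps)
    also have "\<dots> = real N ^ (2 * M + 1)"
      using N by (intro powr_realpow) simp
    finally have "(real N powr (real M + 1 / 2))\<^sup>2 = real N ^ (2 * M + 1)" .
    moreover have "((2::real) ^ M)\<^sup>2 = (2\<^sup>2) ^ M" by (simp only: power_mult[symmetric] mult.commute)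
    ultimately show ?thesis unfolding power_divide by simp
  qed
  finally have "(det ?T)\<^sup>2 = ?r\<^sup>2" .
  \<comment> \<open>The last node is \<open>2 * pi * (N - 1) / N\<close>, still less than a full
    turn after the first; positivity selects the root of the squared equation.\<close>
  moreover have "det ?T > 0"
    unfolding N
    by (intro det_trig_mat_pos strict_mono_onI divide_strict_right_mono mult_strict_left_mono)
      (auto simp: field_simps)
  ultimately show ?thesis by (simp add: power2_eq_iff_nonneg)
qed

section \<open>Factorisation and unique solvability\<close>

lemma mtm_mat_eq:
  assumes N: "N = 2 * M + 1"
  shows "mtm_mat N M \<rho> R0 = trig_mat N (\<lambda>j. 2 * pi * real j / real N) * scaling_mat M \<rho> R0"
proof (rule eq_matI)
  fix i c
  let ?x = "\<lambda>j. 2 * pi * real j / real N"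
  assume "i < dim_row (trig_mat N ?x * scaling_mat M \<rho> R0)"
    "c < dim_col (trig_mat N ?x * scaling_mat M \<rho> R0)"
  then have ic: "i < N" "c < N" by (simp_all add: trig_mat_def scaling_mat_def N)
  have "(trig_mat N ?x * scaling_mat M \<rho> R0) $$ (i, c)
      = (\<Sum>d\<in>{0..<N}. trig_mat N ?x $$ (i, d) * scaling_mat M \<rho> R0 $$ (d, c))"
    using ic by (simp add: trig_mat_def scaling_mat_def scalar_prod_def N)
  also have "\<dots> = (\<Sum>d\<in>{0..<N}.
      if d = c then trig_mode c (?x i) * scaling_mat M \<rho> R0 $$ (c, c) else 0)"
    using ic by (intro sum.cong) (auto simp: trig_mat_def scaling_mat_def N)
  \<comment> \<open>Row \<open>i\<close> belongs to collocation point \<open>i + 1\<close>, so the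
    shift in \<open>colloc_angle\<close> cancels and the angle is
    \<open>2 * pi * i / N\<close>.\<close>
  also have "\<dots> = mtm_mat N M \<rho> R0 $$ (i, c)"
    using ic unfolding N
    by (auto simp: mtm_mat_def scaling_mat_def Let_def colloc_angle_def trig_mode_def
        mode_phase_def cos_diff)
  finally show "mtm_mat N M \<rho> R0 $$ (i, c) = (trig_mat N ?x * scaling_mat M \<rho> R0) $$ (i, c)" ..
qed (simp_all add: N mtm_mat_def trig_mat_def scaling_mat_def)

lemma det_nonzero_inverse:
  fixes A :: "'a :: field mat"
  assumes A: "A \<in> carrier_mat n n" and "det A \<noteq> 0"
  obtains B where "B \<in> carrier_mat n n" "A * B = 1\<^sub>m n" "B * A = 1\<^sub>m n"
  \<comment> \<open>The unit value only fills the extra argument of the matrix ring record; being a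
    unit there means having a two-sided inverse.\<close>
  using det_non_zero_imp_unit[OF assms, of "()"] that
  by (auto simp: Units_def ring_mat_def)

theorem proposition6:
  fixes M N :: nat and \<rho> R0 :: real
  assumes "M \<ge> 1" and "N = 2 * M + 1" and "\<rho> > 0" and "R0 > 0"
  shows "det (scaling_mat M \<rho> R0) = (R0 / \<rho>) ^ (M * (M + 1)) \<and>
         det (mtm_mat N M \<rho> R0)
           = real N powr (real M + 1 / 2) / 2 ^ M * (R0 / \<rho>) ^ (M * (M + 1)) \<and>
         invertible_mat (mtm_mat N M \<rho> R0) \<and>
         (\<forall>g \<in> carrier_vec N. \<exists>!y. y \<in> carrier_vec (2 * M + 1) \<and> mtm_mat N M \<rho> R0 *\<^sub>v y = g)"
proof -
  let ?S = "mtm_mat N M \<rho> R0"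
  have S: "?S \<in> carrier_mat N N"
    by (simp add: mtm_mat_def assms(2))
  have det_S: "det ?S = real N powr (real M + 1 / 2) / 2 ^ M * (R0 / \<rho>) ^ (M * (M + 1))"
    unfolding mtm_mat_eq[OF assms(2)] det_trig_mat_equispaced[OF assms(2), symmetric]
      det_scaling_mat[symmetric]
    by (rule det_mult[where n = N]) (simp_all add: scaling_mat_def assms(2))
  then have "det ?S \<noteq> 0" using assms by simp
  then obtain B where B: "B \<in> carrier_mat N N" "?S * B = 1\<^sub>m N" "B * ?S = 1\<^sub>m N"
    using det_nonzero_inverse[OF S] by blast
  have "invertible_mat ?S"
    using S B by (auto simp: invertible_mat_def inverts_mat_def intro!: exI[of _ B])
  moreover have "\<exists>!y. y \<in> carrier_vec (2 * M + 1) \<and> ?S *\<^sub>v y = g" if g: "g \<in> carrier_vec N" for g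
  proof (rule ex1I[of _ "B *\<^sub>v g"])
    show "B *\<^sub>v g \<in> carrier_vec (2 * M + 1) \<and> ?S *\<^sub>v (B *\<^sub>v g) = g"
      using B S g assms(2) by (simp flip: assoc_mult_mat_vec[of _ N N _ N])
  next
    fix y assume y: "y \<in> carrier_vec (2 * M + 1) \<and> ?S *\<^sub>v y = g"
    then have "B *\<^sub>v g = (B * ?S) *\<^sub>v y"
      using B(1) S assms(2) by (simp add: assoc_mult_mat_vec[of _ N N _ N])
    then show "y = B *\<^sub>v g" using B(3) y assms(2) by simp
  qed
  ultimately show ?thesis using det_scaling_mat det_S by blast
qed

end
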